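(* Let $\mathcal{C}=\{f\in\mathcal{F}:\sigma_{j+r}(f)\le ab^r\sigma_j(f)\ \forall j,r\in\mathbb{N}\}$ with $0<b<1<a$. Let $\mathrm{ALG}$ be the algorithm that, given $f$ and $\varepsilon>0$, returns $\mathrm{ALG}(f,\varepsilon)=\mathrm{APP}(f,n_j)$ for the smallest $j\in\mathbb{N}$ with $\mathrm{ERR}_j(f)\le\varepsilon$. Then $\mathrm{ALG}\in\mathcal{A}(\mathcal{C})$, i.e. $\|\mathrm{SOL}(f)-\mathrm{ALG}(f,\varepsilon)\|_{\mathcal{G}}\le\varepsilon$ for all $\varepsilon>0$, $f\in\mathcal{C}$. The information cost is $\mathrm{COST}(\mathrm{ALG},f,\varepsilon)=n_{j^*}$, where $$j^*=\min\{j\in\mathbb{N}:\mathrm{ERR}_j(f)\le\varepsilon\}.$$ Moreover, for $R>0$, $\mathrm{COST}(\mathrm{ALG},\mathcal{C},\varepsilon,R)\le n_{j^\dagger}$, where $$j^\dagger=\min\Bigl\{j\in\mathbb{N}:\bigl\|(b^{j+r}\Lambda_{j+r})_{r=1}^\infty\bigr\|_\tau\le\frac{b\,\varepsilon}{Ra^2}\Bigl(\frac{1-b^{j\rho}}{1-b^\rho}\Bigr)^{1/\rho}\Bigr\}.$$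
   Context: Setting. $\mathbb{K}$ is a countably infinite index set of "wavenumbers" and $1\le\tau\le\rho\le\infty$. The weights $\boldsymbol{\lambda}=(\lambda_{\boldsymbol{k}})_{\boldsymbol{k}\in\mathbb{K}}$ are positive, and $\mathbb{K}=\{\boldsymbol{k}_1,\boldsymbol{k}_2,\dots\}$ is enumerated so that $\lambda_{\boldsymbol{k}_1}\ge\lambda_{\boldsymbol{k}_2}\ge\cdots>0$. The number $\rho'\in[\tau,\infty]$ is defined by $1/\rho+1/\rho'=1/\tau$, and it is assumed throughout that $\|\boldsymbol{\lambda}\|_{\rho'}<\infty$. Here $\|\cdot\|_p$ is the $\ell^p$ norm of a sequence, and $\mathbb{N}=\{1,2,\dots\}$. The input and output Banach spaces, with bases $\{u_{\boldsymbol{k}}\}$ and $\{v_{\boldsymbol{k}}\}$ (elements are identified with their coefficient sequences), are $$\mathcal{F}=\Bigl\{f=\sum_{\boldsymbol{k}\in\mathbb{K}}\widehat f(\boldsymbol{k})u_{\boldsymbol{k}}:\|f\|_{\mathcal{F}}:=\bigl\|(\widehat f(\boldsymbol{k})/\lambda_{\boldsymbol{k}})_{\boldsymbol{k}\in\mathbb{K}}\bigr\|_\rho<\infty\Bigr\},\quad \mathcal{G}=\Bigl\{g=\sum_{\boldsymbol{k}\in\mathbb{K}}\widehat g(\boldsymbol{k})v_{\boldsymbol{k}}:\|g\|_{\mathcal{G}}:=\bigl\|(\widehat g(\boldsymbol{k}))_{\boldsymbol{k}\in\mathbb{K}}\bigr\|_\tau<\infty\Bigr\}.$$ The solution operator is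 $\mathrm{SOL}:\mathcal{F}\to\mathcal{G}$, $\mathrm{SOL}(f)=\sum_{\boldsymbol{k}}\widehat f(\boldsymbol{k})v_{\boldsymbol{k}}$. $\mathcal{B}_R=\{f\in\mathcal{F}:\|f\|_{\mathcal{F}}\le R\}$. $\mathrm{APP}(f,0)=0$, $\mathrm{APP}(f,n)=\sum_{i=1}^n\widehat f(\boldsymbol{k}_i)v_{\boldsymbol{k}_i}$. Let $(n_j)_{j\ge0}$ be a strictly increasing sequence of non-negative integers, $n_{-1}=0$, and for $j\in\mathbb{N}_0$ let $\mathcal{K}_j=\{\boldsymbol{k}_{n_{j-1}+1},\dots,\boldsymbol{k}_{n_j}\}$ (empty for $j=0$ if $n_0=0$), $$\sigma_j(f)=\bigl\|(\widehat f(\boldsymbol{k})/\lambda_{\boldsymbol{k}})_{\boldsymbol{k}\in\mathcal{K}_j}\bigr\|_\rho,\qquad \Lambda_j=\bigl\|(\lambda_{\boldsymbol{k}})_{\boldsymbol{k}\in\mathcal{K}_j}\bigr\|_{\rho'},\qquad \mathrm{ERR}_j(f)=a\,\sigma_j(f)\,\bigl\|(b^r\Lambda_{j+r})_{r=1}^\infty\bigr\|_\tau\ (j\in\mathbb{N}).$$ For $\rho=\infty$, $\bigl((1-b^{j\rho})/(1-b^\rho)\bigr)^{1/\rho}$ is read as $1$. For $\mathcal{C}\subseteq\mathcal{F}$, $\mathcal{A}(\mathcal{C})$ is the set of all (deterministic) algorithms that use only finitely many series coefficients of the input (the number and choice of which may depend adaptively on the coefficient values already observed and on $\varepsilon$)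 and satisfy $\|\mathrm{SOL}(f)-\mathrm{ALG}(f,\varepsilon)\|_{\mathcal{G}}\le\varepsilon$ for all $\varepsilon>0$, $f\in\mathcal{C}$. $\mathrm{COST}(\mathrm{ALG},f,\varepsilon)$ is the number of series coefficients used by $\mathrm{ALG}(f,\varepsilon)$, and $\mathrm{COST}(\mathrm{ALG},\mathcal{C},\varepsilon,R)=\max_{f\in\mathcal{C}\cap\mathcal{B}_R}\mathrm{COST}(\mathrm{ALG},f,\varepsilon)$. *)

theory Defs
  imports "HOL-Analysis.Analysis"
begin

text \<open>The norm takes values in \<^typ>\<open>ennreal\<close>, so that divergence gives \<open>\<infinity>\<close>; it is meant
  for exponents \<open>1 \<le> p \<le> \<infinity>\<close>. The supremum over an empty index set is \<open>0\<close>.\<close>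

definition lp_norm :: "ennreal \<Rightarrow> 'i set \<Rightarrow> ('i \<Rightarrow> 'a::real_normed_vector) \<Rightarrow> ennreal" where
  "lp_norm p A x =
     (if p = \<infinity> then (SUP k\<in>A. ennreal (norm (x k)))
      else let s = (\<Sum>\<^sub>\<infinity>k\<in>A. ennreal (norm (x k) powr enn2real p))
           in if s = \<infinity> then \<infinity> else ennreal (enn2real s powr (1 / enn2real p)))"

text \<open>The wavenumbers are the elements of the type \<open>'k\<close>. Elements of the input and output spaces
  are identified with their coefficient sequences \<open>'k \<Rightarrow> 'a\<close> with respect to the respective bases;
  in these coordinates the solution operator does not change the coefficients.\<close>

definition norm_F :: "ennreal \<Rightarrow> ('k \<Rightarrow> real) \<Rightarrow> ('k \<Rightarrow> 'a::real_normed_vector) \<Rightarrow> ennreal" where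
  "norm_F \<rho> lam f = lp_norm \<rho> UNIV (\<lambda>k. f k /\<^sub>R lam k)"

definition space_F :: "ennreal \<Rightarrow> ('k \<Rightarrow> real) \<Rightarrow> ('k \<Rightarrow> 'a::real_normed_vector) set" where
  "space_F \<rho> lam = {f. norm_F \<rho> lam f < \<infinity>}"

definition norm_G :: "ennreal \<Rightarrow> ('k \<Rightarrow> 'a::real_normed_vector) \<Rightarrow> ennreal" where
  "norm_G \<tau> g = lp_norm \<tau> UNIV g"

definition space_G :: "ennreal \<Rightarrow> ('k \<Rightarrow> 'a::real_normed_vector) set" where
  "space_G \<tau> = {g. norm_G \<tau> g < \<infinity>}"

definition SOL :: "('k \<Rightarrow> 'a) \<Rightarrow> ('k \<Rightarrow> 'a)" where
  "SOL f = (\<lambda>k. f k)"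

definition ball_F :: "ennreal \<Rightarrow> ('k \<Rightarrow> real) \<Rightarrow> real \<Rightarrow> ('k \<Rightarrow> 'a::real_normed_vector) set" where
  "ball_F \<rho> lam R = {f \<in> space_F \<rho> lam. norm_F \<rho> lam f \<le> ennreal R}"

text \<open>The enumeration \<open>kk\<close> of the wavenumbers starts at index \<open>1\<close>; its value at \<open>0\<close> is never used.\<close>

definition APP :: "(nat \<Rightarrow> 'k) \<Rightarrow> ('k \<Rightarrow> 'a::zero) \<Rightarrow> nat \<Rightarrow> ('k \<Rightarrow> 'a)" where
  "APP kk f m = (\<lambda>k. if k \<in> kk ` {1..m} then f k else 0)"

definition block :: "(nat \<Rightarrow> 'k) \<Rightarrow> (nat \<Rightarrow> nat) \<Rightarrow> nat \<Rightarrow> 'k set" where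
  "block kk n j = kk ` {(if j = 0 then 0 else n (j - 1)) <.. n j}"

text \<open>Blocks are finite, so the norms in the next two definitions are finite and \<^const>\<open>enn2real\<close>
  loses nothing.\<close>

definition sigma ::
  "ennreal \<Rightarrow> ('k \<Rightarrow> real) \<Rightarrow> (nat \<Rightarrow> 'k) \<Rightarrow> (nat \<Rightarrow> nat) \<Rightarrow> nat \<Rightarrow> ('k \<Rightarrow> 'a::real_normed_vector) \<Rightarrow> real" where
  "sigma \<rho> lam kk n j f = enn2real (lp_norm \<rho> (block kk n j) (\<lambda>k. f k /\<^sub>R lam k))"

definition Lam ::
  "ennreal \<Rightarrow> ('k \<Rightarrow> real) \<Rightarrow> (nat \<Rightarrow> 'k) \<Rightarrow> (nat \<Rightarrow> nat) \<Rightarrow> nat \<Rightarrow> real" where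
  "Lam \<rho>' lam kk n j = enn2real (lp_norm \<rho>' (block kk n j) lam)"

definition ERR ::
  "ennreal \<Rightarrow> ennreal \<Rightarrow> ennreal \<Rightarrow> ('k \<Rightarrow> real) \<Rightarrow> (nat \<Rightarrow> 'k) \<Rightarrow> (nat \<Rightarrow> nat) \<Rightarrow> real \<Rightarrow> real
    \<Rightarrow> nat \<Rightarrow> ('k \<Rightarrow> 'a::real_normed_vector) \<Rightarrow> ennreal" where
  "ERR \<tau> \<rho> \<rho>' lam kk n a b j f =
     ennreal (a * sigma \<rho> lam kk n j f) * lp_norm \<tau> {1..} (\<lambda>r. b ^ r * Lam \<rho>' lam kk n (j + r))"

definition decay_cone ::
  "ennreal \<Rightarrow> ('k \<Rightarrow> real) \<Rightarrow> (nat \<Rightarrow> 'k) \<Rightarrow> (nat \<Rightarrow> nat) \<Rightarrow> real \<Rightarrow> real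
    \<Rightarrow> ('k \<Rightarrow> 'a::real_normed_vector) set" where
  "decay_cone \<rho> lam kk n a b =
     {f \<in> space_F \<rho> lam.
        \<forall>j\<ge>1. \<forall>r\<ge>1. sigma \<rho> lam kk n (j + r) f \<le> a * b ^ r * sigma \<rho> lam kk n j f}"

definition geom_factor :: "real \<Rightarrow> ennreal \<Rightarrow> nat \<Rightarrow> real" where
  "geom_factor b \<rho> j =
     (if \<rho> = \<infinity> then 1
      else ((1 - b powr (real j * enn2real \<rho>)) / (1 - b powr enn2real \<rho>)) powr (1 / enn2real \<rho>))"

text \<open>Given the tolerance and the list of coefficients observed so far (wavenumbers paired with
  values, oldest first), an algorithm either asks for one more coefficient of the input or stops
  with an output. The input is accessible only through these queries. An algorithm need not stop
  on every input.\<close>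

datatype ('k, 'a) action = Query 'k | Return "'k \<Rightarrow> 'a"

type_synonym ('k, 'a) algorithm = "real \<Rightarrow> ('k \<times> 'a) list \<Rightarrow> ('k, 'a) action"

primrec observed :: "('k, 'a) algorithm \<Rightarrow> ('k \<Rightarrow> 'a) \<Rightarrow> real \<Rightarrow> nat \<Rightarrow> ('k \<times> 'a) list" where
  "observed alg f \<epsilon> 0 = []"
| "observed alg f \<epsilon> (Suc m) =
     (case alg \<epsilon> (observed alg f \<epsilon> m) of
        Query k \<Rightarrow> observed alg f \<epsilon> m @ [(k, f k)]
      | Return g \<Rightarrow> observed alg f \<epsilon> m)"

definition halts_at :: "('k, 'a) algorithm \<Rightarrow> ('k \<Rightarrow> 'a) \<Rightarrow> real \<Rightarrow> nat \<Rightarrow> bool" where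
  "halts_at alg f \<epsilon> m \<longleftrightarrow> (\<exists>g. alg \<epsilon> (observed alg f \<epsilon> m) = Return g)"

definition halts :: "('k, 'a) algorithm \<Rightarrow> ('k \<Rightarrow> 'a) \<Rightarrow> real \<Rightarrow> bool" where
  "halts alg f \<epsilon> \<longleftrightarrow> (\<exists>m. halts_at alg f \<epsilon> m)"

definition final_data :: "('k, 'a) algorithm \<Rightarrow> ('k \<Rightarrow> 'a) \<Rightarrow> real \<Rightarrow> ('k \<times> 'a) list" where
  "final_data alg f \<epsilon> = observed alg f \<epsilon> (LEAST m. halts_at alg f \<epsilon> m)"

text \<open>The result is meaningful only if the algorithm halts.\<close>

definition result :: "('k, 'a) algorithm \<Rightarrow> ('k \<Rightarrow> 'a) \<Rightarrow> real \<Rightarrow> ('k \<Rightarrow> 'a)" where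
  "result alg f \<epsilon> = (THE g. alg \<epsilon> (final_data alg f \<epsilon>) = Return g)"

definition COST :: "('k, 'a) algorithm \<Rightarrow> ('k \<Rightarrow> 'a) \<Rightarrow> real \<Rightarrow> enat" where
  "COST alg f \<epsilon> =
     (if halts alg f \<epsilon> then enat (card (fst ` set (final_data alg f \<epsilon>))) else \<infinity>)"

text \<open>A finite supremum of a nonempty set of extended naturals is attained, so it is a maximum.\<close>

definition COST_max ::
  "ennreal \<Rightarrow> ('k \<Rightarrow> real) \<Rightarrow> ('k, 'a::real_normed_vector) algorithm \<Rightarrow> ('k \<Rightarrow> 'a) set
    \<Rightarrow> real \<Rightarrow> real \<Rightarrow> enat" where
  "COST_max \<rho> lam alg C \<epsilon> R = (SUP f \<in> C \<inter> ball_F \<rho> lam R. COST alg f \<epsilon>)"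

definition algorithms ::
  "ennreal \<Rightarrow> ('k \<Rightarrow> 'a::real_normed_vector) set \<Rightarrow> ('k, 'a) algorithm set" where
  "algorithms \<tau> C =
     {alg. \<forall>\<epsilon>>0. \<forall>f\<in>C. halts alg f \<epsilon> \<and> result alg f \<epsilon> \<in> space_G \<tau>
             \<and> norm_G \<tau> (\<lambda>k. SOL f k - result alg f \<epsilon> k) \<le> ennreal \<epsilon>}"

definition from_data :: "('k \<times> 'a::zero) list \<Rightarrow> ('k \<Rightarrow> 'a)" where
  "from_data h k = (case map_of h k of None \<Rightarrow> 0 | Some v \<Rightarrow> v)"

text \<open>The coefficients are requested in the order of the enumeration. Whenever the blocks up to
  some \<open>j \<ge> 1\<close> have just been completed, the error bound for that \<open>j\<close> is tested. It involves only
  coefficients in the block \<open>j\<close>, so evaluating it (and the approximation) at the zero extension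
  of the observed data gives the same value as evaluating it at the unknown input.\<close>

definition cone_ALG ::
  "ennreal \<Rightarrow> ennreal \<Rightarrow> ennreal \<Rightarrow> ('k \<Rightarrow> real) \<Rightarrow> (nat \<Rightarrow> 'k) \<Rightarrow> (nat \<Rightarrow> nat) \<Rightarrow> real \<Rightarrow> real
    \<Rightarrow> ('k, 'a::real_normed_vector) algorithm" where
  "cone_ALG \<tau> \<rho> \<rho>' lam kk n a b \<epsilon> h =
     (if \<exists>j\<ge>1. n j = length h \<and> ERR \<tau> \<rho> \<rho>' lam kk n a b j (from_data h) \<le> ennreal \<epsilon>
      then Return (APP kk (from_data h) (length h))
      else Query (kk (Suc (length h))))"

end

theory Submission
  imports Defs
begin

text \<open>\<^bold>\<open>Why the theorem holds.\<close> Past level \<open>j\<close> the truncation error \<open>f - APP f (n j)\<close> lives on the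
  disjoint blocks \<open>j + r\<close> with \<open>r \<ge> 1\<close>, so its \<open>\<tau>\<close>-norm is the \<open>\<tau>\<close>-norm of the sequence of its block
  norms (\<open>lp_norm_UNION\<close>). Since \<open>1/\<rho> + 1/\<rho>' = 1/\<tau>\<close>, Hoelder's inequality (\<open>lp_norm_Hoelder\<close>) bounds
  the \<open>\<tau>\<close>-norm of \<open>f\<close> on block \<open>j + r\<close> by \<open>\<sigma>\<^sub>j\<^sub>+\<^sub>r(f) \<Lambda>\<^sub>j\<^sub>+\<^sub>r\<close>, and membership in the cone bounds this by
  \<open>a b\<^sup>r \<sigma>\<^sub>j(f) \<Lambda>\<^sub>j\<^sub>+\<^sub>r\<close>. Summing up gives exactly \<open>ERR\<^sub>j(f)\<close> (\<open>norm_G_tail_le_ERR\<close>), so an algorithm that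
  stops as soon as \<open>ERR\<^sub>j(f) \<le> \<epsilon>\<close> meets the tolerance. It does stop: in the cone \<open>\<sigma>\<^sub>j(f)\<close> decays
  geometrically, while the weighted norms of the \<open>\<Lambda>\<close>'s stay bounded because the weights have
  finite \<open>\<rho>'\<close>-norm (\<open>exists_ERR_le\<close>).

  The cone condition also reads backwards: a large \<open>\<sigma>\<^sub>j(f)\<close> forces every earlier \<open>\<sigma>\<^sub>i(f)\<close> to be at
  least \<open>\<sigma>\<^sub>j(f) / (a b\<^sup>j\<^sup>-\<^sup>i)\<close>. The \<open>\<rho>\<close>-norm of these lower bounds over \<open>i = 1, ..., j\<close> is a finite
  geometric sum and cannot exceed the norm \<open>R\<close> of the input. This bounds \<open>\<sigma>\<^sub>j(f)\<close> for
  all inputs of the ball at once (\<open>sigma_le_of_ball\<close>), and inserting the bound into \<open>ERR\<^sub>j(f)\<close> gives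
  the a priori stopping level (\<open>ERR_le_of_ball\<close>).

  The formal algorithm sees only a list of observed pairs. The link to the description by \<open>j\<^sup>*\<close> is
  that before stopping the list always records the first coefficients in the order of the
  enumeration, and that \<open>ERR\<^sub>j\<close> depends on the input through block \<open>j\<close> only (\<open>ERR_APP\<close>, \<open>cone_ALG_run\<close>).\<close>

section \<open>Norms of sequences\<close>

lemma exponent_cases:
  fixes p :: ennreal
  assumes "1 \<le> p"
  obtains (infinite) "p = top" | (real) q where "1 \<le> q" "p = ennreal q"
proof (cases p)
  case (real r)
  with assms have "1 \<le> r" by (simp add: ennreal_ge_1)
  with real that show thesis by blast
qed (use that in simp)

text \<open>For a real exponent the norm is the \<open>q\<close>-th root of this sum; arguing with the sum itself avoids
  the case distinction between a finite and an infinite norm.\<close>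

definition power_sum :: "real \<Rightarrow> 'i set \<Rightarrow> ('i \<Rightarrow> 'a::real_normed_vector) \<Rightarrow> ennreal" where
  "power_sum q A x = (\<Sum>\<^sub>\<infinity>k\<in>A. ennreal (norm (x k) powr q))"

lemma lp_norm_top: "lp_norm top A x = (SUP k\<in>A. ennreal (norm (x k)))"
  by (simp add: lp_norm_def)

lemma lp_norm_real:
  assumes "1 \<le> q"
  shows "lp_norm (ennreal q) A x =
    (if power_sum q A x = \<infinity> then \<infinity> else ennreal (enn2real (power_sum q A x) powr (1 / q)))"
  using assms by (simp add: lp_norm_def Let_def power_sum_def)

lemma power_sum_finite_iff:
  assumes "1 \<le> q"
  shows "power_sum q A x < \<infinity> \<longleftrightarrow> lp_norm (ennreal q) A x < \<infinity>"
  by (auto simp: lp_norm_real[OF assms] less_top)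

lemma power_sum_eq:
  assumes q: "1 \<le> q" and fin: "lp_norm (ennreal q) A x < \<infinity>"
  shows "power_sum q A x = ennreal (enn2real (lp_norm (ennreal q) A x) powr q)"
proof -
  have "power_sum q A x < \<infinity>"
    using fin by (simp only: power_sum_finite_iff[OF q])
  then show ?thesis
    using q by (simp add: lp_norm_real powr_powr)
qed

lemma lp_norm_le_iff:
  assumes q: "1 \<le> q" and c: "0 \<le> c"
  shows "lp_norm (ennreal q) A x \<le> ennreal c \<longleftrightarrow> power_sum q A x \<le> ennreal (c powr q)"
proof (cases "power_sum q A x")
  case (real s)
  have "s powr (1 / q) \<le> c \<longleftrightarrow> (s powr (1 / q)) powr q \<le> c powr q"
    using q c by (metis linorder_not_le powr_less_mono2 powr_mono2 powr_ge_zero zero_less_one order_less_le_trans order_less_imp_le)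
  also have "(s powr (1 / q)) powr q = s"
    using q real by (simp add: powr_powr)
  finally show ?thesis
    using real q c by (simp add: lp_norm_real ennreal_le_iff)
qed (use q in \<open>auto simp: lp_norm_real top_unique\<close>)

lemma power_sum_SUP: "power_sum q A x = (SUP F\<in>{F. finite F \<and> F \<subseteq> A}. ennreal (\<Sum>k\<in>F. norm (x k) powr q))"
  by (simp add: power_sum_def nonneg_infsum_complete sum_ennreal)

lemma power_sum_finite: "finite A \<Longrightarrow> power_sum q A x = ennreal (\<Sum>k\<in>A. norm (x k) powr q)"
  by (simp add: power_sum_def sum_ennreal)

lemma lp_norm_le_power_sum:
  assumes q: "1 \<le> q" and le: "power_sum q A x \<le> power_sum q B y"
  shows "lp_norm (ennreal q) A x \<le> lp_norm (ennreal q) B y"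
proof (cases "lp_norm (ennreal q) B y")
  case (real c)
  then show ?thesis
    using lp_norm_le_iff[OF q real(1), of A x] lp_norm_le_iff[OF q real(1), of B y] le by auto
qed simp

lemma lp_norm_cong:
  assumes "\<And>k. k \<in> A \<Longrightarrow> norm (x k) = norm (y k)"
  shows "lp_norm p A x = lp_norm p A y"
  using assms by (simp add: lp_norm_def cong: infsum_cong SUP_cong)

lemma lp_norm_mono:
  assumes p: "1 \<le> p" and le: "\<And>k. k \<in> A \<Longrightarrow> norm (x k) \<le> norm (y k)"
  shows "lp_norm p A x \<le> lp_norm p A y"
  using p
proof (cases rule: exponent_cases)
  case infinite
  then show ?thesis
    unfolding infinite lp_norm_top by (intro SUP_mono) (metis ennreal_leI le)
next
  case (real q)
  then have "power_sum q A x \<le> power_sum q A y"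
    unfolding power_sum_def using le
    by (intro infsum_mono nonneg_summable_on_complete) (auto intro!: ennreal_leI powr_mono2)
  with real show ?thesis by (simp add: lp_norm_le_power_sum)
qed

lemma lp_norm_neutral:
  assumes p: "1 \<le> p" and sub: "A \<subseteq> B" and zero: "\<And>k. k \<in> B - A \<Longrightarrow> x k = 0"
  shows "lp_norm p B x = lp_norm p A x"
  using p
proof (cases rule: exponent_cases)
  case infinite
  have "(SUP k\<in>B. ennreal (norm (x k))) \<le> (SUP k\<in>A. ennreal (norm (x k)))"
  proof (rule SUP_least)
    fix k assume "k \<in> B"
    then show "ennreal (norm (x k)) \<le> (SUP k\<in>A. ennreal (norm (x k)))"
      using zero[of k] by (cases "k \<in> A") (auto intro: SUP_upper)
  qed
  with infinite sub show ?thesis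
    by (auto simp: lp_norm_top intro!: antisym SUP_subset_mono)
next
  case (real q)
  have "power_sum q B x = power_sum q A x"
    unfolding power_sum_def using sub zero by (intro infsum_cong_neutral) auto
  with real show ?thesis by (simp add: lp_norm_real)
qed

lemma lp_norm_mono_set:
  assumes p: "1 \<le> p" and sub: "A \<subseteq> B"
  shows "lp_norm p A x \<le> lp_norm p B x"
proof -
  let ?y = "\<lambda>k. if k \<in> A then x k else 0"
  have "lp_norm p A x = lp_norm p A ?y"
    by (rule lp_norm_cong) simp
  also have "\<dots> = lp_norm p B ?y"
    using p sub by (intro lp_norm_neutral[symmetric]) auto
  also have "\<dots> \<le> lp_norm p B x"
    using p by (rule lp_norm_mono) auto
  finally show ?thesis .
qed

lemma lp_norm_finite:
  assumes p: "1 \<le> p" and A: "finite A"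
  shows "lp_norm p A x < \<infinity>"
  using p
proof (cases rule: exponent_cases)
  case infinite
  have "(SUP k\<in>A. ennreal (norm (x k))) \<le> ennreal (\<Sum>k\<in>A. norm (x k))"
    using A by (intro SUP_least ennreal_leI member_le_sum) auto
  with infinite show ?thesis
    by (simp add: lp_norm_top le_less_trans)
next
  case (real q)
  then show ?thesis
    using A by (simp add: lp_norm_real power_sum_finite)
qed

text \<open>Only \<open>\<le>\<close> for positive factors needs an argument; the converse inequality is the same statement
  for the factor \<open>inverse c\<close>.\<close>

lemma lp_norm_scale:
  fixes x :: "'i \<Rightarrow> real"
  assumes p: "1 \<le> p" and c: "0 \<le> c"
  shows "lp_norm p A (\<lambda>k. c * x k) = ennreal c * lp_norm p A x"
proof -
  have le: "lp_norm p A (\<lambda>k. c * x k) \<le> ennreal c * lp_norm p A x"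
    if "0 < c" for c and x :: "'i \<Rightarrow> real"
  proof (cases "lp_norm p A x")
    case v: (real v)
    have "lp_norm p A (\<lambda>k. c * x k) \<le> ennreal (c * v)"
      using p
    proof (cases rule: exponent_cases)
      case infinite
      have "ennreal \<bar>x k\<bar> \<le> ennreal v" if "k \<in> A" for k
        using SUP_upper[OF that, of "\<lambda>k. ennreal (norm (x k))"] v infinite
        by (simp add: lp_norm_top)
      then show ?thesis
        using \<open>0 < c\<close> v by (auto simp: infinite lp_norm_top abs_mult intro!: SUP_least ennreal_leI)
    next
      case (real q)
      have "ennreal (\<Sum>k\<in>F. norm (c * x k) powr q) \<le> ennreal ((c * v) powr q)"
        if "finite F" "F \<subseteq> A" for F
      proof -
        have "ennreal (\<Sum>k\<in>F. norm (x k) powr q) \<le> power_sum q A x"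
          unfolding power_sum_SUP using that by (intro SUP_upper) auto
        also have "\<dots> \<le> ennreal (v powr q)"
          using lp_norm_le_iff[OF real(1) v(1), of A x] v real by simp
        finally have "(\<Sum>k\<in>F. norm (x k) powr q) \<le> v powr q"
          by (simp add: ennreal_le_iff)
        then have "c powr q * (\<Sum>k\<in>F. norm (x k) powr q) \<le> c powr q * v powr q"
          by (simp add: mult_left_mono)
        with \<open>0 < c\<close> v show ?thesis
          by (intro ennreal_leI) (simp add: abs_mult powr_mult sum_distrib_left)
      qed
      then have "power_sum q A (\<lambda>k. c * x k) \<le> ennreal ((c * v) powr q)"
        unfolding power_sum_SUP by (intro SUP_least) auto
      with real v \<open>0 < c\<close> show ?thesis by (simp add: lp_norm_le_iff)
    qed
    with v \<open>0 < c\<close> show ?thesis by (simp add: ennreal_mult)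
  next
    case top
    with that show ?thesis by (simp add: ennreal_mult_top)
  qed
  show ?thesis
  proof (cases "c = 0")
    case True
    have "lp_norm p A (\<lambda>k. 0 :: real) = lp_norm p ({} :: 'i set) (\<lambda>k. 0 :: real)"
      using p by (intro lp_norm_neutral) auto
    also have "\<dots> = 0"
      by (simp add: lp_norm_def bot_ennreal)
    finally show ?thesis by (simp add: True)
  next
    case False
    with c have "0 < c" by simp
    have "ennreal c * lp_norm p A x = ennreal c * lp_norm p A (\<lambda>k. inverse c * (c * x k))"
      using \<open>0 < c\<close> by (simp add: field_simps)
    also have "\<dots> \<le> ennreal c * (ennreal (inverse c) * lp_norm p A (\<lambda>k. c * x k))"
      using \<open>0 < c\<close> by (intro mult_left_mono le) auto
    also have "\<dots> = lp_norm p A (\<lambda>k. c * x k)"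
      using \<open>0 < c\<close> by (simp add: mult.assoc[symmetric] ennreal_mult[symmetric])
    finally show ?thesis
      using le[OF \<open>0 < c\<close>, of x] by (rule antisym[rotated])
  qed
qed

text \<open>An infinite sum of extended nonnegative reals is the supremum of its finite partial sums, and a
  finite set of indices from the union meets only finitely many of the blocks. So it is enough to
  group finitely many blocks, where the sums add up.\<close>

lemma infsum_UNION_ennreal:
  fixes f :: "'i \<Rightarrow> ennreal"
  assumes disj: "disjoint_family_on B I"
  shows "infsum f (\<Union>i\<in>I. B i) = (\<Sum>\<^sub>\<infinity>i\<in>I. infsum f (B i))"
proof (rule antisym)
  have summable: "g summable_on A" for g :: "'x \<Rightarrow> ennreal" and A
    by (rule nonneg_summable_on_complete) simp
  have fin: "infsum f (\<Union>i\<in>J. B i) = (\<Sum>i\<in>J. infsum f (B i))" if "finite J" "J \<subseteq> I" for J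
    using that disj
    by (intro infsumI sum_has_sum has_sum_infsum summable) (auto simp: disjoint_family_on_def)
  show "infsum f (\<Union>i\<in>I. B i) \<le> (\<Sum>\<^sub>\<infinity>i\<in>I. infsum f (B i))"
  proof (subst nonneg_infsum_complete, simp, rule SUP_least, clarify)
    fix F assume F: "finite F" "F \<subseteq> (\<Union>i\<in>I. B i)"
    then have "\<forall>k\<in>F. \<exists>i. i \<in> I \<and> k \<in> B i" by blast
    then obtain g where g: "\<forall>k\<in>F. g k \<in> I \<and> k \<in> B (g k)"
      by (rule bchoice[THEN exE])
    define J where "J = g ` F"
    have J: "finite J" "J \<subseteq> I" "F \<subseteq> (\<Union>i\<in>J. B i)"
      using F(1) g by (auto simp: J_def)
    have "sum f F = infsum f F"
      using F by simp
    also have "\<dots> \<le> infsum f (\<Union>i\<in>J. B i)"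
      using J by (intro infsum_mono_neutral summable nonneg_summable_on_complete) auto
    also have "\<dots> = infsum (\<lambda>i. infsum f (B i)) J"
      using fin[OF J(1,2)] J(1) by simp
    also have "\<dots> \<le> (\<Sum>\<^sub>\<infinity>i\<in>I. infsum f (B i))"
      using J by (intro infsum_mono_neutral nonneg_summable_on_complete) auto
    finally show "sum f F \<le> (\<Sum>\<^sub>\<infinity>i\<in>I. infsum f (B i))" .
  qed
  show "(\<Sum>\<^sub>\<infinity>i\<in>I. infsum f (B i)) \<le> infsum f (\<Union>i\<in>I. B i)"
  proof (subst nonneg_infsum_complete, simp, rule SUP_least, clarify)
    fix J assume J: "finite J" "J \<subseteq> I"
    then have "(\<Sum>i\<in>J. infsum f (B i)) = infsum f (\<Union>i\<in>J. B i)"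
      by (simp add: fin)
    also have "\<dots> \<le> infsum f (\<Union>i\<in>I. B i)"
      using J by (intro infsum_mono_neutral nonneg_summable_on_complete) auto
    finally show "(\<Sum>i\<in>J. infsum f (B i)) \<le> infsum f (\<Union>i\<in>I. B i)" .
  qed
qed

text \<open>The norm can be computed blockwise. Both halves of the theorem rest on this: the truncation error
  is split over the blocks that are missing, and the norm of the input over those already seen.\<close>

lemma lp_norm_UNION:
  assumes p: "1 \<le> p" and disj: "disjoint_family_on B I"
    and fin: "\<And>i. i \<in> I \<Longrightarrow> lp_norm p (B i) x < \<infinity>"
  shows "lp_norm p (\<Union>i\<in>I. B i) x = lp_norm p I (\<lambda>i. enn2real (lp_norm p (B i) x))"
  using p
proof (cases rule: exponent_cases)
  case infinite
  have "lp_norm p (\<Union>i\<in>I. B i) x = (SUP i\<in>I. lp_norm p (B i) x)"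
    by (simp add: infinite lp_norm_top SUP_UNION)
  also have "\<dots> = (SUP i\<in>I. ennreal (norm (enn2real (lp_norm p (B i) x))))"
    using fin by (intro SUP_cong) auto
  finally show ?thesis
    by (simp add: infinite lp_norm_top)
next
  case (real q)
  have "power_sum q (\<Union>i\<in>I. B i) x = (\<Sum>\<^sub>\<infinity>i\<in>I. power_sum q (B i) x)"
    unfolding power_sum_def using disj by (rule infsum_UNION_ennreal)
  also have "\<dots> = power_sum q I (\<lambda>i. enn2real (lp_norm p (B i) x))"
    unfolding power_sum_def[of q I] using fin real
    by (intro infsum_cong) (simp add: power_sum_eq)
  finally show ?thesis
    using real by (simp add: lp_norm_real)
qed

section \<open>Hoelder's inequality on finite index sets\<close>

lemma inverse_exponent_eqD:
  fixes p q :: ennreal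
  assumes "1 \<le> p" "1 \<le> q" "inverse p = inverse q"
  shows "p = q"
  using assms(1)
proof (cases rule: exponent_cases)
  case infinite
  then show ?thesis
    using assms(3) by simp
next
  case p: (real r)
  show ?thesis
    using assms(2)
  proof (cases rule: exponent_cases)
    case infinite
    then show ?thesis
      using assms(3) by simp
  next
    case (real s)
    then show ?thesis
      using p assms(3) by (simp add: inverse_ennreal)
  qed
qed

text \<open>After division by the norms of the factors, each summand is bounded by Young's inequality with
  the weights \<open>t / p\<close> and \<open>t / q\<close>; the conjugacy relation says that these weights add up to \<open>1\<close>.\<close>

lemma Hoelder_sum:
  fixes x y :: "'i \<Rightarrow> real"
  assumes B: "finite B" and pos: "0 < p" "0 < q" "0 < t" and conj: "1 / p + 1 / q = 1 / t"
    and nonneg: "\<And>k. 0 \<le> x k" "\<And>k. 0 \<le> y k"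
  shows "(\<Sum>k\<in>B. (x k * y k) powr t) \<le> (\<Sum>k\<in>B. x k powr p) powr (t / p) * (\<Sum>k\<in>B. y k powr q) powr (t / q)"
proof -
  define X Y where "X = (\<Sum>k\<in>B. x k powr p)" and "Y = (\<Sum>k\<in>B. y k powr q)"
  have nn: "0 \<le> X" "0 \<le> Y" by (simp_all add: X_def Y_def sum_nonneg)
  show ?thesis
  proof (cases "X = 0 \<or> Y = 0")
    case True
    then have "x k = 0 \<or> y k = 0" if "k \<in> B" for k
      using that B by (auto simp: X_def Y_def sum_nonneg_eq_0_iff)
    then have "(\<Sum>k\<in>B. (x k * y k) powr t) = 0"
      by (intro sum.neutral) auto
    then show ?thesis by simp
  next
    case False
    with nn have XY: "0 < X" "0 < Y" by auto
    have weights: "t / p + t / q = 1"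
      using conj pos by (simp add: divide_inverse flip: distrib_left)
    have "(x k * y k) powr t \<le> X powr (t / p) * Y powr (t / q) * (t / p * (x k powr p / X) + t / q * (y k powr q / Y))"
      if "k \<in> B" for k
    proof (cases "x k = 0 \<or> y k = 0")
      case True
      with pos XY show ?thesis by auto
    next
      case False
      with nonneg[of k] have xy: "0 < x k" "0 < y k"
        by (simp_all add: order_less_le)
      have "(x k powr p / X) powr (t / p) * (y k powr q / Y) powr (t / q) \<le> t / p * (x k powr p / X) + t / q * (y k powr q / Y)"
        using pos XY xy weights by (intro Youngs_inequality_0) auto
      moreover have "(x k powr p / X) powr (t / p) * (y k powr q / Y) powr (t / q)
          = (x k * y k) powr t / (X powr (t / p) * Y powr (t / q))"
        using pos XY xy by (simp add: powr_divide powr_powr powr_mult)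
      ultimately show ?thesis
        using XY by (simp add: divide_le_eq mult.commute)
    qed
    then have "(\<Sum>k\<in>B. (x k * y k) powr t)
        \<le> (\<Sum>k\<in>B. X powr (t / p) * Y powr (t / q) * (t / p * (x k powr p / X) + t / q * (y k powr q / Y)))"
      by (rule sum_mono)
    also have "\<dots> = X powr (t / p) * Y powr (t / q) * (t / p * (X / X) + t / q * (Y / Y))"
      unfolding sum_distrib_left[symmetric] sum.distrib sum_divide_distrib[symmetric]
      by (simp add: X_def Y_def)
    also have "\<dots> = X powr (t / p) * Y powr (t / q)"
      using XY weights by simp
    finally show ?thesis by (simp add: X_def Y_def)
  qed
qed

text \<open>If one of the exponents is infinite then the other one equals \<open>t\<close>, and the inequality amounts to
  pulling out a supremum. This includes the case that all three are infinite.\<close>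

lemma lp_norm_Hoelder:
  fixes x :: "'i \<Rightarrow> 'a::real_normed_vector" and y :: "'i \<Rightarrow> 'b::real_normed_vector"
    and z :: "'i \<Rightarrow> 'c::real_normed_vector"
  assumes exps: "1 \<le> p" "1 \<le> q" "1 \<le> t" and conj: "inverse p + inverse q = inverse t"
    and B: "finite B" and le: "\<And>k. k \<in> B \<Longrightarrow> norm (z k) \<le> norm (x k) * norm (y k)"
  shows "enn2real (lp_norm t B z) \<le> enn2real (lp_norm p B x) * enn2real (lp_norm q B y)"
proof -
  have sup: "enn2real (lp_norm t B z) \<le> enn2real (lp_norm top B u) * enn2real (lp_norm t B v)"
    if "\<And>k. k \<in> B \<Longrightarrow> norm (z k) \<le> norm (u k) * norm (v k)"
    for u :: "'i \<Rightarrow> 'd::real_normed_vector" and v :: "'i \<Rightarrow> 'e::real_normed_vector"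
  proof -
    define c where "c = enn2real (lp_norm top B u)"
    have c: "ennreal c = lp_norm top B u"
      using lp_norm_finite[OF _ B, of top u] by (simp add: c_def)
    have "norm (z k) \<le> norm (c * norm (v k))" if "k \<in> B" for k
    proof -
      have "ennreal (norm (u k)) \<le> ennreal c"
        unfolding c lp_norm_top using that by (rule SUP_upper)
      then have "norm (u k) \<le> c"
        using ennreal_le_iff[of c] by (simp add: c_def)
      then have "norm (u k) * norm (v k) \<le> norm (c * norm (v k))"
        by (simp add: c_def mult_right_mono)
      with \<open>\<And>k. k \<in> B \<Longrightarrow> norm (z k) \<le> norm (u k) * norm (v k)\<close>[OF that] show ?thesis by linarith
    qed
    then have "lp_norm t B z \<le> lp_norm t B (\<lambda>k. c * norm (v k))"
      using exps by (intro lp_norm_mono)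
    also have "\<dots> = ennreal c * lp_norm t B (\<lambda>k. norm (v k))"
      using exps by (intro lp_norm_scale) (simp_all add: c_def)
    also have "lp_norm t B (\<lambda>k. norm (v k)) = lp_norm t B v"
      by (rule lp_norm_cong) simp
    finally have "enn2real (lp_norm t B z) \<le> enn2real (ennreal c * lp_norm t B v)"
      using lp_norm_finite[OF exps(3) B, of v]
      by (intro enn2real_mono) (auto simp: ennreal_mult_less_top)
    then show ?thesis by (simp add: enn2real_mult c_def)
  qed
  show ?thesis
    using exps(1)
  proof (cases rule: exponent_cases)
    case infinite
    with conj have "inverse q = inverse t" by simp
    then have "q = t" by (rule inverse_exponent_eqD[OF exps(2,3)])
    with infinite sup[of x y] le show ?thesis by simp
  next
    case p: (real p')
    show ?thesis
      using exps(2)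
    proof (cases rule: exponent_cases)
      case infinite
      with conj have "inverse p = inverse t" by simp
      then have "p = t" by (rule inverse_exponent_eqD[OF exps(1,3)])
      with infinite sup[of y x] le show ?thesis by (simp add: mult.commute)
    next
      case q: (real q')
      have "t \<noteq> top"
        using conj p q by (auto simp: inverse_ennreal)
      with exps(3) obtain t' where t: "1 \<le> t'" "t = ennreal t'"
        by (cases rule: exponent_cases) auto
      have conj': "1 / p' + 1 / q' = 1 / t'"
        using conj p q t by (simp add: inverse_ennreal inverse_eq_divide flip: ennreal_plus)
      define X Y where "X = (\<Sum>k\<in>B. norm (x k) powr p')" and "Y = (\<Sum>k\<in>B. norm (y k) powr q')"
      have norms: "enn2real (lp_norm p B x) = X powr (1 / p')" "enn2real (lp_norm q B y) = Y powr (1 / q')"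
        using p q B by (simp_all add: lp_norm_real power_sum_finite X_def Y_def sum_nonneg)
      have "(\<Sum>k\<in>B. norm (z k) powr t') \<le> (\<Sum>k\<in>B. (norm (x k) * norm (y k)) powr t')"
        using le t by (intro sum_mono powr_mono2) auto
      also have "\<dots> \<le> X powr (t' / p') * Y powr (t' / q')"
        unfolding X_def Y_def using p q t conj' B by (intro Hoelder_sum) auto
      also have "\<dots> = (X powr (1 / p') * Y powr (1 / q')) powr t'"
        using p q t by (simp add: powr_mult powr_powr X_def Y_def sum_nonneg)
      finally have "lp_norm t B z \<le> ennreal (X powr (1 / p') * Y powr (1 / q'))"
        using t B by (simp add: lp_norm_le_iff power_sum_finite ennreal_leI)
      then show ?thesis
        unfolding norms by (rule enn2real_leI[rotated]) simp
    qed
  qed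
qed

section \<open>Norms of geometric sequences\<close>

lemma lp_norm_geometric_finite:
  fixes b :: real
  assumes p: "1 \<le> p" and b: "0 < b" "b < 1" and j: "1 \<le> j"
  shows "lp_norm p {1..j} (\<lambda>i. b ^ (i - 1)) = ennreal (geom_factor b p j)"
  using p
proof (cases rule: exponent_cases)
  case infinite
  have "(SUP i\<in>{1..j}. ennreal (norm (b ^ (i - 1)))) = 1"
  proof (rule antisym)
    show "(SUP i\<in>{1..j}. ennreal (norm (b ^ (i - 1)))) \<le> 1"
      using b by (intro SUP_least) (simp add: power_le_one)
    show "1 \<le> (SUP i\<in>{1..j}. ennreal (norm (b ^ (i - 1))))"
      using j by (intro SUP_upper2[of 1]) auto
  qed
  with infinite show ?thesis by (simp add: lp_norm_top geom_factor_def)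
next
  case (real q)
  have powr_of_power: "(b ^ i) powr q = (b powr q) ^ i" for i
    using b by (simp add: powr_realpow[symmetric] powr_powr mult.commute)
  have "b powr q < 1"
    using b real by (simp add: powr01_less_one)
  have "(\<Sum>i\<in>{1..j}. norm (b ^ (i - 1)) powr q) = (\<Sum>i<j. norm (b ^ i) powr q)"
    by (intro sum.reindex_bij_witness[of _ Suc "\<lambda>i. i - 1"]) auto
  also have "\<dots> = (\<Sum>i<j. (b powr q) ^ i)"
    using b by (simp add: powr_of_power)
  also have "\<dots> = (1 - (b powr q) ^ j) / (1 - b powr q)"
    using \<open>b powr q < 1\<close> by (simp add: geometric_sum field_simps)
  also have "(b powr q) ^ j = b powr (real j * q)"
    using b by (simp add: powr_realpow[symmetric] powr_powr mult.commute)
  finally have "power_sum q {1..j} (\<lambda>i. b ^ (i - 1)) = ennreal ((1 - b powr (real j * q)) / (1 - b powr q))"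
    by (simp add: power_sum_finite)
  moreover have "b powr (real j * q) \<le> 1"
    using b real by (simp add: powr_le1)
  ultimately show ?thesis
    using real \<open>b powr q < 1\<close> by (simp add: lp_norm_real geom_factor_def)
qed

lemma lp_norm_singleton: "1 \<le> p \<Longrightarrow> lp_norm p {k} x = ennreal (norm (x k))"
  by (erule exponent_cases) (simp_all add: lp_norm_top lp_norm_real power_sum_finite powr_powr)

text \<open>The first term of the geometric sequence is \<open>1\<close>.\<close>

lemma geom_factor_ge_1:
  assumes "1 \<le> p" "0 < b" "b < 1" "1 \<le> j"
  shows "1 \<le> geom_factor b p j"
proof -
  have "lp_norm p {1} (\<lambda>i. b ^ (i - 1)) \<le> lp_norm p {1..j} (\<lambda>i. b ^ (i - 1))"
    using assms by (intro lp_norm_mono_set) auto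
  then have "1 \<le> ennreal (geom_factor b p j)"
    using assms by (simp only: lp_norm_geometric_finite lp_norm_singleton) simp
  then show ?thesis by (simp add: ennreal_ge_1)
qed

text \<open>For a ratio below \<open>1\<close>, raising the terms to a power \<open>q \<ge> 1\<close> only decreases them, so the
  ordinary geometric series bounds the norm for every exponent.\<close>

lemma lp_norm_geometric_le:
  fixes b :: real
  assumes p: "1 \<le> p" and b: "0 < b" "b < 1"
  shows "lp_norm p {1..} (\<lambda>r. b ^ r) \<le> ennreal (1 / (1 - b))"
  using p
proof (cases rule: exponent_cases)
  case infinite
  have "b ^ r \<le> 1 / (1 - b)" for r
    using b power_le_one[of b r] by (simp add: field_simps) (smt (verit) mult_nonneg_nonneg zero_le_power)
  with infinite b show ?thesis
    by (auto simp: lp_norm_top intro!: SUP_least ennreal_leI)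
next
  case (real q)
  have "(\<Sum>r\<in>F. norm (b ^ r) powr q) \<le> (1 / (1 - b)) powr q" if "finite F" for F
  proof -
    have "norm (b ^ r) powr q \<le> b ^ r" for r
      using b real powr_mono'[of 1 q "b ^ r"] by (simp add: power_le_one)
    then have "(\<Sum>r\<in>F. norm (b ^ r) powr q) \<le> (\<Sum>r\<in>F. b ^ r)"
      by (intro sum_mono)
    also have "\<dots> \<le> (\<Sum>r. b ^ r)"
      using b that by (intro sum_le_suminf summable_geometric) auto
    also have "\<dots> = 1 / (1 - b)"
      using b by (intro suminf_geometric) auto
    also have "\<dots> \<le> (1 / (1 - b)) powr q"
      using b real powr_mono[of 1 q "1 / (1 - b)"] by simp
    finally show ?thesis .
  qed
  then have "power_sum q {1..} (\<lambda>r. b ^ r) \<le> ennreal ((1 / (1 - b)) powr q)"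
    unfolding power_sum_SUP by (intro SUP_least ennreal_leI) auto
  with real b show ?thesis by (simp add: lp_norm_le_iff)
qed

section \<open>Blocks and the truncation error\<close>

lemma finite_block: "finite (block kk n j)"
  by (simp add: block_def)

lemma disjoint_blocks:
  assumes kk: "inj_on kk {1..}" and n: "strict_mono n"
  shows "disjoint_family_on (block kk n) {1..}"
proof -
  have "block kk n i \<inter> block kk n j = {}" if "1 \<le> i" "i < j" for i j
  proof -
    have "n i \<le> n (j - 1)"
      using that n by (simp add: strict_mono_less_eq)
    then have "{(if i = 0 then 0 else n (i - 1)) <.. n i} \<inter> {(if j = 0 then 0 else n (j - 1)) <.. n j} = {}"
      using that by auto
    moreover have "{(if i = 0 then 0 else n (i - 1)) <.. n i} \<subseteq> {1..}" "{(if j = 0 then 0 else n (j - 1)) <.. n j} \<subseteq> {1..}"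
      by auto
    ultimately show ?thesis
      unfolding block_def by (metis image_empty inj_on_image_Int[OF kk])
  qed
  then show ?thesis
    unfolding disjoint_family_on_def by (metis Int_commute atLeast_iff linorder_neqE_nat)
qed

lemma block_subset: "block kk n j \<subseteq> kk ` {1..n j}"
  unfolding block_def by (intro image_mono) auto

lemma tail_eq_UN_blocks:
  assumes kk: "bij_betw kk {1..} UNIV" and n: "strict_mono n"
  shows "- kk ` {1..n j} = (\<Union>r\<in>{1..}. block kk n (j + r))"
proof -
  have "- kk ` {1..n j} = kk ` {n j <..}"
  proof -
    have "kk ` ({1..} - {1..n j}) = kk ` {1..} - kk ` {1..n j}"
      using kk by (intro inj_on_image_set_diff[of _ "{1..}"]) (auto simp: bij_betw_def)
    moreover have "{1..} - {1..n j} = {n j <..}" by auto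
    ultimately show ?thesis
      using kk by (auto simp: bij_betw_def)
  qed
  also have "{n j <..} = (\<Union>r\<in>{1..}. {n (j + r - 1) <.. n (j + r)})"
  proof (intro equalityI subsetI)
    fix i assume "i \<in> {n j <..}"
    define r where "r = (LEAST r. i \<le> n (j + r))"
    have "i \<le> n i"
      using n by (rule strict_mono_imp_increasing)
    also have "\<dots> \<le> n (j + i)"
      using n by (simp add: strict_mono_less_eq)
    finally have upper: "i \<le> n (j + r)"
      unfolding r_def by (rule LeastI)
    then have "r \<noteq> 0"
      using \<open>i \<in> {n j <..}\<close> by (intro notI) simp
    then have "\<not> i \<le> n (j + (r - 1))"
      unfolding r_def by (intro not_less_Least) simp
    with upper \<open>r \<noteq> 0\<close> show "i \<in> (\<Union>r\<in>{1..}. {n (j + r - 1) <.. n (j + r)})"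
      by (intro UN_I[of r]) auto
  next
    fix i assume "i \<in> (\<Union>r\<in>{1..}. {n (j + r - 1) <.. n (j + r)})"
    then obtain r where r: "1 \<le> r" "n (j + r - 1) < i" by auto
    then have "n j \<le> n (j + r - 1)"
      using n by (simp add: strict_mono_less_eq)
    with r show "i \<in> {n j <..}" by simp
  qed
  also have "kk ` \<dots> = (\<Union>r\<in>{1..}. block kk n (j + r))"
    unfolding image_UN by (intro SUP_cong) (auto simp: block_def)
  finally show ?thesis .
qed

lemma sigma_nonneg: "0 \<le> sigma \<rho> lam kk n j f"
  by (simp add: sigma_def)

lemma Lam_nonneg: "0 \<le> Lam \<rho>' lam kk n j"
  by (simp add: Lam_def)

text \<open>On block \<open>j + r\<close>, write \<open>f\<close> as the product of \<open>f / lam\<close> and \<open>lam\<close>. Hoelder's inequality yields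
  \<open>\<sigma>\<^sub>j\<^sub>+\<^sub>r(f) \<Lambda>\<^sub>j\<^sub>+\<^sub>r\<close>, and the cone condition replaces the unseen \<open>\<sigma>\<^sub>j\<^sub>+\<^sub>r(f)\<close> by the observable
  \<open>a b\<^sup>r \<sigma>\<^sub>j(f)\<close>. The \<open>\<tau>\<close>-norm over all \<open>r\<close> is the error bound.\<close>

lemma norm_G_tail_le_ERR:
  fixes f :: "'k \<Rightarrow> 'a::real_normed_vector"
  assumes exps: "1 \<le> \<tau>" "\<tau> \<le> \<rho>" "\<tau> \<le> \<rho>'" "inverse \<rho> + inverse \<rho>' = inverse \<tau>"
    and kk: "bij_betw kk {1..} UNIV" and lam: "\<And>k. 0 < lam k" and n: "strict_mono n"
    and f: "f \<in> decay_cone \<rho> lam kk n a b" and j: "1 \<le> j" and ab: "0 < a" "0 < b"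
  shows "norm_G \<tau> (\<lambda>k. f k - APP kk f (n j) k) \<le> ERR \<tau> \<rho> \<rho>' lam kk n a b j f"
proof -
  have exps': "1 \<le> \<rho>" "1 \<le> \<rho>'"
    using exps order.trans by blast+
  let ?\<sigma> = "\<lambda>j. sigma \<rho> lam kk n j f" and ?\<Lambda> = "Lam \<rho>' lam kk n"
  let ?B = "\<lambda>r. block kk n (j + r)"
  have disj: "disjoint_family_on ?B {1..}"
    using disjoint_blocks[OF bij_betw_imp_inj_on[OF kk] n]
    unfolding disjoint_family_on_def by simp
  have "norm_G \<tau> (\<lambda>k. f k - APP kk f (n j) k)
      = lp_norm \<tau> (\<Union>r\<in>{1..}. ?B r) (\<lambda>k. f k - APP kk f (n j) k)"
    unfolding norm_G_def tail_eq_UN_blocks[OF kk n, symmetric]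
    using exps by (intro lp_norm_neutral) (auto simp: APP_def)
  also have "\<dots> = lp_norm \<tau> (\<Union>r\<in>{1..}. ?B r) f"
    unfolding tail_eq_UN_blocks[OF kk n, symmetric]
    by (intro lp_norm_cong) (auto simp: APP_def)
  also have "\<dots> = lp_norm \<tau> {1..} (\<lambda>r. enn2real (lp_norm \<tau> (?B r) f))"
    using exps disj by (intro lp_norm_UNION lp_norm_finite finite_block)
  also have "\<dots> \<le> lp_norm \<tau> {1..} (\<lambda>r. (a * ?\<sigma> j) * (b ^ r * ?\<Lambda> (j + r)))"
  proof (rule lp_norm_mono[OF exps(1)])
    fix r :: nat assume r: "r \<in> {1..}"
    have "norm (f k) \<le> norm (f k /\<^sub>R lam k) * norm (lam k)" for k
      using lam[of k] by (simp add: field_simps)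
    then have "enn2real (lp_norm \<tau> (?B r) f) \<le> ?\<sigma> (j + r) * ?\<Lambda> (j + r)"
      unfolding sigma_def Lam_def
      using exps exps' by (intro lp_norm_Hoelder finite_block) auto
    also have "\<dots> \<le> (a * b ^ r * ?\<sigma> j) * ?\<Lambda> (j + r)"
      using f r j by (intro mult_right_mono Lam_nonneg) (auto simp: decay_cone_def)
    finally show "norm (enn2real (lp_norm \<tau> (?B r) f)) \<le> norm ((a * ?\<sigma> j) * (b ^ r * ?\<Lambda> (j + r)))"
      using ab by (simp add: sigma_nonneg Lam_nonneg mult_ac abs_mult)
  qed
  also have "\<dots> = ERR \<tau> \<rho> \<rho>' lam kk n a b j f"
    unfolding ERR_def using exps ab by (intro lp_norm_scale) (auto simp: sigma_nonneg)
  finally show ?thesis .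
qed

section \<open>The run of the algorithm\<close>

definition observation_log :: "(nat \<Rightarrow> 'k) \<Rightarrow> ('k \<Rightarrow> 'a) \<Rightarrow> nat \<Rightarrow> ('k \<times> 'a) list" where
  "observation_log kk f m = map (\<lambda>i. (kk i, f (kk i))) [1..<Suc m]"

lemma length_observation_log [simp]: "length (observation_log kk f m) = m"
  by (simp add: observation_log_def)

lemma observation_log_Suc:
  "observation_log kk f (Suc m) = observation_log kk f m @ [(kk (Suc m), f (kk (Suc m)))]"
  by (simp add: observation_log_def)

lemma fst_set_observation_log: "fst ` set (observation_log kk f m) = kk ` {1..m}"
  by (simp add: observation_log_def image_image atLeastLessThanSuc_atLeastAtMost del: upt_Suc)

text \<open>A wavenumber that is listed more than once carries the same value each time, so the lookup does
  not depend on the order of the list.\<close>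

lemma from_data_observation_log: "from_data (observation_log kk f m) = APP kk f m"
proof -
  have "map_of (map (\<lambda>i. (kk i, f (kk i))) xs) k = (if k \<in> kk ` set xs then Some (f k) else None)"
    for xs :: "nat list" and k
    by (induction xs) auto
  then show ?thesis
    by (auto simp: fun_eq_iff from_data_def observation_log_def APP_def
        atLeastLessThanSuc_atLeastAtMost simp del: upt_Suc)
qed

text \<open>The error bound at level \<open>j\<close> involves the input only through its coefficients in block \<open>j\<close>, and
  these are among the first \<open>n j\<close>. Hence the algorithm can evaluate the bound for the unknown input
  from the data it has at that time.\<close>

lemma ERR_APP: "ERR \<tau> \<rho> \<rho>' lam kk n a b j (APP kk f (n j)) = ERR \<tau> \<rho> \<rho>' lam kk n a b j f"
proof -
  have "lp_norm \<rho> (block kk n j) (\<lambda>k. APP kk f (n j) k /\<^sub>R lam k)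
      = lp_norm \<rho> (block kk n j) (\<lambda>k. f k /\<^sub>R lam k)"
    using block_subset[of kk n j] by (intro lp_norm_cong) (auto simp: APP_def)
  then show ?thesis by (simp add: ERR_def sigma_def)
qed

text \<open>The decision of the algorithm, expressed by the input instead of the observed data.\<close>

lemma cone_ALG_observation_log:
  "cone_ALG \<tau> \<rho> \<rho>' lam kk n a b \<epsilon> (observation_log kk f m) =
    (if \<exists>j\<ge>1. n j = m \<and> ERR \<tau> \<rho> \<rho>' lam kk n a b j f \<le> ennreal \<epsilon>
     then Return (APP kk f m) else Query (kk (Suc m)))"
proof -
  have "n j = m \<and> ERR \<tau> \<rho> \<rho>' lam kk n a b j (APP kk f m) \<le> ennreal \<epsilon>
      \<longleftrightarrow> n j = m \<and> ERR \<tau> \<rho> \<rho>' lam kk n a b j f \<le> ennreal \<epsilon>" for j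
    using ERR_APP[of \<tau> \<rho> \<rho>' lam kk n a b j f] by auto
  then have "(\<exists>j\<ge>1. n j = m \<and> ERR \<tau> \<rho> \<rho>' lam kk n a b j (APP kk f m) \<le> ennreal \<epsilon>)
      \<longleftrightarrow> (\<exists>j\<ge>1. n j = m \<and> ERR \<tau> \<rho> \<rho>' lam kk n a b j f \<le> ennreal \<epsilon>)"
    by blast
  moreover have "APP kk (APP kk f m) m = APP kk f m"
    by (simp add: APP_def fun_eq_iff)
  ultimately show ?thesis
    unfolding cone_ALG_def from_data_observation_log length_observation_log by (simp only:)
qed

text \<open>Tests take place exactly when the number of observations is some \<open>n j\<close> with \<open>j \<ge> 1\<close>. As \<open>n\<close> is
  strictly increasing, the first successful test is that of the least level \<open>j\<close> whose error bound
  is small enough. Up to then each step asks for a new wavenumber, so the cost is the number of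
  steps.\<close>

lemma cone_ALG_run:
  fixes f :: "'k \<Rightarrow> 'a::real_normed_vector"
  assumes kk: "inj_on kk {1..}" and n: "strict_mono n"
    and ex: "\<exists>j\<ge>1. ERR \<tau> \<rho> \<rho>' lam kk n a b j f \<le> ennreal \<epsilon>"
  defines "alg \<equiv> cone_ALG \<tau> \<rho> \<rho>' lam kk n a b"
    and "j \<equiv> LEAST j. 1 \<le> j \<and> ERR \<tau> \<rho> \<rho>' lam kk n a b j f \<le> ennreal \<epsilon>"
  shows "halts alg f \<epsilon>" "result alg f \<epsilon> = APP kk f (n j)" "COST alg f \<epsilon> = enat (n j)"
proof -
  have j: "1 \<le> j" "ERR \<tau> \<rho> \<rho>' lam kk n a b j f \<le> ennreal \<epsilon>"
    unfolding j_def using LeastI_ex[OF ex] by auto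
  have first: "n j \<le> m" if "\<exists>j\<ge>1. n j = m \<and> ERR \<tau> \<rho> \<rho>' lam kk n a b j f \<le> ennreal \<epsilon>" for m
  proof -
    from that obtain i where i: "1 \<le> i" "n i = m" "ERR \<tau> \<rho> \<rho>' lam kk n a b i f \<le> ennreal \<epsilon>"
      by blast
    then have "j \<le> i"
      unfolding j_def by (intro Least_le) simp
    with n show ?thesis by (simp add: strict_mono_less_eq flip: i(2))
  qed
  have log: "observed alg f \<epsilon> m = observation_log kk f m" if "m \<le> n j" for m
    using that
  proof (induction m)
    case 0
    then show ?case by (simp add: observation_log_def)
  next
    case (Suc m)
    then have "\<not> (\<exists>j\<ge>1. n j = m \<and> ERR \<tau> \<rho> \<rho>' lam kk n a b j f \<le> ennreal \<epsilon>)"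
      using first[of m] by auto
    then have "alg \<epsilon> (observation_log kk f m) = Query (kk (Suc m))"
      unfolding alg_def cone_ALG_observation_log by (rule if_not_P)
    with Suc show ?case by (simp add: observation_log_Suc)
  qed
  have ret: "alg \<epsilon> (observation_log kk f (n j)) = Return (APP kk f (n j))"
    unfolding alg_def cone_ALG_observation_log using j by auto
  have halt: "halts_at alg f \<epsilon> (n j)"
    by (simp add: halts_at_def log ret)
  then show halts: "halts alg f \<epsilon>"
    by (auto simp: halts_def)
  have "(LEAST m. halts_at alg f \<epsilon> m) = n j"
  proof (rule Least_equality)
    show "halts_at alg f \<epsilon> (n j)" by (fact halt)
  next
    fix m assume "halts_at alg f \<epsilon> m"
    show "n j \<le> m"
    proof (rule ccontr)
      assume "\<not> n j \<le> m"
      with \<open>halts_at alg f \<epsilon> m\<close> log[of m]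
      obtain g where "cone_ALG \<tau> \<rho> \<rho>' lam kk n a b \<epsilon> (observation_log kk f m) = Return g"
        by (auto simp: halts_at_def alg_def)
      then have "\<exists>j\<ge>1. n j = m \<and> ERR \<tau> \<rho> \<rho>' lam kk n a b j f \<le> ennreal \<epsilon>"
        unfolding cone_ALG_observation_log by (metis action.distinct(1))
      from first[OF this] \<open>\<not> n j \<le> m\<close> show False by simp
    qed
  qed
  then have final: "final_data alg f \<epsilon> = observation_log kk f (n j)"
    by (simp add: final_data_def log)
  show "result alg f \<epsilon> = APP kk f (n j)"
    by (simp add: result_def final ret)
  have "card (kk ` {1..n j}) = n j"
    using kk by (subst card_image) (auto intro: inj_on_subset)
  then show "COST alg f \<epsilon> = enat (n j)"
    using halts by (simp only: COST_def final fst_set_observation_log if_True)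
qed

lemma APP_in_space_G:
  assumes "1 \<le> \<tau>"
  shows "APP kk f m \<in> space_G \<tau>"
proof -
  have "norm_G \<tau> (APP kk f m) = lp_norm \<tau> (kk ` {1..m}) (APP kk f m)"
    unfolding norm_G_def using assms by (intro lp_norm_neutral) (auto simp: APP_def)
  also have "\<dots> < \<infinity>"
    using assms by (intro lp_norm_finite) auto
  finally show ?thesis by (simp add: space_G_def)
qed

section \<open>Termination for every input in the cone\<close>

text \<open>Each \<open>\<Lambda>\<^sub>j\<close> is at most the \<open>\<rho>'\<close>-norm of all weights, which leaves a geometric sequence; the bound
  does not depend on \<open>j\<close>.\<close>

lemma weighted_Lam_bounded:
  assumes tau: "1 \<le> \<tau>" and rho': "1 \<le> \<rho>'" and fin: "lp_norm \<rho>' UNIV lam < \<infinity>"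
    and b: "0 < b" "b < 1"
  obtains L where "0 \<le> L"
    "\<And>j. lp_norm \<tau> {1..} (\<lambda>r. b ^ r * Lam \<rho>' lam kk n (j + r)) \<le> ennreal L"
proof
  define M where "M = enn2real (lp_norm \<rho>' UNIV lam)"
  show "0 \<le> M * (1 / (1 - b))"
    using b by (simp add: M_def)
  fix j
  have "lp_norm \<tau> {1..} (\<lambda>r. b ^ r * Lam \<rho>' lam kk n (j + r)) \<le> lp_norm \<tau> {1..} (\<lambda>r. M * b ^ r)"
  proof (rule lp_norm_mono[OF tau])
    fix r
    have "Lam \<rho>' lam kk n (j + r) \<le> M"
      unfolding Lam_def M_def using fin rho' by (intro enn2real_mono lp_norm_mono_set) auto
    then show "norm (b ^ r * Lam \<rho>' lam kk n (j + r)) \<le> norm (M * b ^ r)"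
      using b by (simp add: abs_mult Lam_nonneg M_def mult.commute mult_right_mono)
  qed
  also have "\<dots> = ennreal M * lp_norm \<tau> {1..} (\<lambda>r. b ^ r)"
    by (intro lp_norm_scale tau) (simp add: M_def)
  also have "\<dots> \<le> ennreal M * ennreal (1 / (1 - b))"
    by (intro mult_left_mono lp_norm_geometric_le tau b) simp
  also have "\<dots> = ennreal (M * (1 / (1 - b)))"
    using b by (intro ennreal_mult[symmetric]) (auto simp: M_def)
  finally show "lp_norm \<tau> {1..} (\<lambda>r. b ^ r * Lam \<rho>' lam kk n (j + r)) \<le> ennreal (M * (1 / (1 - b)))" .
qed

lemma exists_power_mult_le:
  fixes b K \<epsilon> :: real
  assumes "0 < b" "b < 1" "0 \<le> K" "0 < \<epsilon>"
  shows "\<exists>m. b ^ m * K \<le> \<epsilon>"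
proof -
  \<comment> \<open>\<open>K\<close> may vanish, \<open>K + 1\<close> cannot.\<close>
  obtain m where "b ^ m < \<epsilon> / (K + 1)"
    using real_arch_pow_inv[of "\<epsilon> / (K + 1)" b] assms by auto
  then have "b ^ m * (K + 1) < \<epsilon>"
    using assms by (simp add: pos_less_divide_eq)
  moreover have "b ^ m * K \<le> b ^ m * (K + 1)"
    using assms by simp
  ultimately show ?thesis by (meson less_imp_le order.trans)
qed

text \<open>The weighted norm of the \<open>\<Lambda>\<close>'s is bounded uniformly in the level, while the factor \<open>\<sigma>\<^sub>j(f)\<close> is at
  most \<open>a b\<^sup>j\<^sup>-\<^sup>1 \<sigma>\<^sub>1(f)\<close> for \<open>j \<ge> 2\<close>.\<close>

lemma exists_ERR_le:
  fixes f :: "'k \<Rightarrow> 'a::real_normed_vector"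
  assumes tau: "1 \<le> \<tau>" and rho': "1 \<le> \<rho>'" and fin: "lp_norm \<rho>' UNIV lam < \<infinity>"
    and ab: "0 < a" "0 < b" "b < 1" and f: "f \<in> decay_cone \<rho> lam kk n a b" and eps: "0 < \<epsilon>"
  shows "\<exists>j\<ge>1. ERR \<tau> \<rho> \<rho>' lam kk n a b j f \<le> ennreal \<epsilon>"
proof -
  let ?\<sigma> = "\<lambda>j. sigma \<rho> lam kk n j f"
  obtain L where L: "0 \<le> L"
    "\<And>j. lp_norm \<tau> {1..} (\<lambda>r. b ^ r * Lam \<rho>' lam kk n (j + r)) \<le> ennreal L"
    using weighted_Lam_bounded[OF tau rho' fin ab(2,3), of kk n] by blast
  obtain m where m: "b ^ m * (a * (a * b * ?\<sigma> 1) * L) \<le> \<epsilon>"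
    using exists_power_mult_le[of b "a * (a * b * ?\<sigma> 1) * L" \<epsilon>] ab eps L(1)
    by (auto simp: sigma_nonneg)
  have "?\<sigma> (1 + Suc m) \<le> a * b ^ Suc m * ?\<sigma> 1"
    using f unfolding decay_cone_def by fastforce
  then have "a * ?\<sigma> (1 + Suc m) * L \<le> a * (a * b ^ Suc m * ?\<sigma> 1) * L"
    using ab L(1) by (intro mult_right_mono mult_left_mono) auto
  also have "\<dots> \<le> \<epsilon>"
    using m by (simp add: mult_ac)
  finally have le: "a * ?\<sigma> (1 + Suc m) * L \<le> \<epsilon>" .
  have "ERR \<tau> \<rho> \<rho>' lam kk n a b (1 + Suc m) f \<le> ennreal (a * ?\<sigma> (1 + Suc m)) * ennreal L"
    unfolding ERR_def using L(2) by (rule mult_left_mono) simp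
  also have "\<dots> = ennreal (a * ?\<sigma> (1 + Suc m) * L)"
    using ab L(1) by (intro ennreal_mult[symmetric]) (auto simp: sigma_nonneg)
  also have "\<dots> \<le> ennreal \<epsilon>"
    using le by (rule ennreal_leI)
  finally show ?thesis
    by (intro exI[of _ "1 + Suc m"]) simp
qed

section \<open>The worst-case cost over a ball\<close>

text \<open>By the cone condition \<open>\<sigma>\<^sub>i(f) \<ge> c b\<^sup>i\<^sup>-\<^sup>1\<close> for \<open>1 \<le> i \<le> j\<close>, where \<open>c = \<sigma>\<^sub>j(f) / (a b\<^sup>j\<^sup>-\<^sup>1)\<close>. The \<open>\<rho>\<close>-norm
  of the right-hand side is \<open>c\<close> times the geometric factor, and that of the left-hand side is the
  norm of \<open>f\<close> on the first blocks, hence at most \<open>R\<close>.\<close>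

lemma sigma_le_of_ball:
  fixes f :: "'k \<Rightarrow> 'a::real_normed_vector"
  assumes rho: "1 \<le> \<rho>" and kk: "bij_betw kk {1..} UNIV" and n: "strict_mono n"
    and f: "f \<in> decay_cone \<rho> lam kk n a b" "f \<in> ball_F \<rho> lam R"
    and j: "1 \<le> j" and ab: "1 < a" "0 < b" "b < 1" and R: "0 < R"
  shows "sigma \<rho> lam kk n j f * geom_factor b \<rho> j \<le> a * R * b ^ (j - 1)"
proof -
  let ?\<sigma> = "\<lambda>j. sigma \<rho> lam kk n j f" and ?g = "\<lambda>k. f k /\<^sub>R lam k"
  define c where "c = ?\<sigma> j / (a * b ^ (j - 1))"
  have c: "0 \<le> c"
    using ab by (simp add: c_def sigma_nonneg)
  have "ennreal (c * geom_factor b \<rho> j) = ennreal c * lp_norm \<rho> {1..j} (\<lambda>i. b ^ (i - 1))"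
    unfolding lp_norm_geometric_finite[OF rho ab(2,3) j] using c by (rule ennreal_mult')
  also have "\<dots> = lp_norm \<rho> {1..j} (\<lambda>i. c * b ^ (i - 1))"
    using rho c by (rule lp_norm_scale[symmetric])
  also have "\<dots> \<le> lp_norm \<rho> {1..j} ?\<sigma>"
  proof (rule lp_norm_mono[OF rho])
    fix i assume i: "i \<in> {1..j}"
    have "?\<sigma> j \<le> a * b ^ (j - i) * ?\<sigma> i"
    proof (cases "i = j")
      \<comment> \<open>The cone condition compares distinct levels only; for equal ones \<open>1 < a\<close> suffices.\<close>
      case True
      with ab show ?thesis
        using mult_right_mono[OF _ sigma_nonneg, of 1 a] by simp
    next
      case False
      with i have "1 \<le> i" "1 \<le> j - i" by auto
      moreover have "\<forall>j\<ge>1. \<forall>r\<ge>1. ?\<sigma> (j + r) \<le> a * b ^ r * ?\<sigma> j"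
        using f(1) by (simp add: decay_cone_def)
      ultimately have "?\<sigma> (i + (j - i)) \<le> a * b ^ (j - i) * ?\<sigma> i"
        by blast
      with i show ?thesis by simp
    qed
    then have "?\<sigma> j * b ^ (i - 1) \<le> a * b ^ (j - i) * ?\<sigma> i * b ^ (i - 1)"
      using ab by (simp add: mult_right_mono)
    also have "\<dots> = ?\<sigma> i * (a * b ^ (j - 1))"
    proof -
      have "b ^ (j - 1) = b ^ (j - i) * b ^ (i - 1)"
        using i by (simp flip: power_add)
      then show ?thesis by (simp only: mult_ac)
    qed
    finally have "c * b ^ (i - 1) \<le> ?\<sigma> i"
      using ab by (simp add: c_def divide_le_eq)
    with c ab show "norm (c * b ^ (i - 1)) \<le> norm (?\<sigma> i)"
      by (simp add: sigma_nonneg)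
  qed
  also have "\<dots> = lp_norm \<rho> (\<Union>i\<in>{1..j}. block kk n i) ?g"
    unfolding sigma_def using rho
    by (intro lp_norm_UNION[symmetric] lp_norm_finite finite_block
        disjoint_family_on_mono[OF _ disjoint_blocks[OF bij_betw_imp_inj_on[OF kk] n]]) auto
  also have "\<dots> \<le> norm_F \<rho> lam f"
    unfolding norm_F_def using rho by (intro lp_norm_mono_set) auto
  also have "\<dots> \<le> ennreal R"
    using f by (simp add: ball_F_def)
  finally have "c * geom_factor b \<rho> j \<le> R"
    using R by (simp add: ennreal_le_iff)
  then have "c * geom_factor b \<rho> j * (a * b ^ (j - 1)) \<le> R * (a * b ^ (j - 1))"
    using ab by (intro mult_right_mono) auto
  moreover have "c * geom_factor b \<rho> j * (a * b ^ (j - 1)) = ?\<sigma> j * geom_factor b \<rho> j"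
    using ab by (simp add: c_def)
  ultimately show ?thesis by (simp only: mult_ac)
qed

lemma lp_norm_shifted_geometric_weight:
  assumes "1 \<le> \<tau>" "0 < b"
  shows "lp_norm \<tau> {1..} (\<lambda>r. b ^ (j + r) * \<Lambda> (j + r))
    = ennreal (b ^ j) * lp_norm \<tau> {1..} (\<lambda>r. b ^ r * \<Lambda> (j + r) :: real)"
  using assms lp_norm_scale[of \<tau> "b ^ j" "{1..}" "\<lambda>r. b ^ r * \<Lambda> (j + r)"]
  by (simp add: power_add mult.assoc)

text \<open>The left-hand side decays like \<open>b\<^sup>j\<close>, whereas the geometric factor on the right is at least \<open>1\<close>.\<close>

lemma exists_a_priori_level:
  assumes exps: "1 \<le> \<tau>" "1 \<le> \<rho>" "1 \<le> \<rho>'" and fin: "lp_norm \<rho>' UNIV lam < \<infinity>"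
    and b: "0 < b" "b < 1" and delta: "0 < \<delta>"
  shows "\<exists>j\<ge>1. lp_norm \<tau> {1..} (\<lambda>r. b ^ (j + r) * Lam \<rho>' lam kk n (j + r))
    \<le> ennreal (\<delta> * geom_factor b \<rho> j)"
proof -
  obtain L where L: "0 \<le> L"
    "\<And>j. lp_norm \<tau> {1..} (\<lambda>r. b ^ r * Lam \<rho>' lam kk n (j + r)) \<le> ennreal L"
    using weighted_Lam_bounded[OF exps(1,3) fin b, of kk n] by blast
  obtain m where m: "b ^ m * (b * L) \<le> \<delta>"
    using exists_power_mult_le[of b "b * L" \<delta>] b delta L(1) by auto
  let ?j = "Suc m"
  have "lp_norm \<tau> {1..} (\<lambda>r. b ^ (?j + r) * Lam \<rho>' lam kk n (?j + r)) \<le> ennreal (b ^ ?j) * ennreal L"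
    unfolding lp_norm_shifted_geometric_weight[OF exps(1) b(1)] using L(2) by (rule mult_left_mono) simp
  also have "\<dots> = ennreal (b ^ ?j * L)"
    using b L(1) by (intro ennreal_mult[symmetric]) auto
  also have "\<dots> \<le> ennreal (\<delta> * geom_factor b \<rho> ?j)"
  proof (rule ennreal_leI)
    have "\<delta> * 1 \<le> \<delta> * geom_factor b \<rho> ?j"
      using delta exps b by (intro mult_left_mono geom_factor_ge_1) auto
    with m show "b ^ ?j * L \<le> \<delta> * geom_factor b \<rho> ?j"
      by (simp add: mult_ac)
  qed
  finally show ?thesis
    by (intro exI[of _ ?j]) simp
qed

text \<open>Inserting \<open>sigma_le_of_ball\<close> into the error bound and extracting \<open>b\<^sup>j\<close> from the weighted norm
  of the \<open>\<Lambda>\<close>'s turns the condition on the level into \<open>ERR\<^sub>j(f) \<le> \<epsilon>\<close>: the geometric factors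
  cancel, and the remaining constants satisfy \<open>a\<^sup>2 R b\<^sup>j\<^sup>-\<^sup>1 \<cdot> b\<^sup>-\<^sup>j \<cdot> b \<epsilon> / (R a\<^sup>2) = \<epsilon>\<close>.\<close>

lemma ERR_le_of_ball:
  fixes f :: "'k \<Rightarrow> 'a::real_normed_vector"
  assumes exps: "1 \<le> \<tau>" "1 \<le> \<rho>" and kk: "bij_betw kk {1..} UNIV" and n: "strict_mono n"
    and f: "f \<in> decay_cone \<rho> lam kk n a b" "f \<in> ball_F \<rho> lam R"
    and j: "1 \<le> j" and ab: "1 < a" "0 < b" "b < 1" and R: "0 < R" and eps: "0 < \<epsilon>"
    and level: "lp_norm \<tau> {1..} (\<lambda>r. b ^ (j + r) * Lam \<rho>' lam kk n (j + r))
      \<le> ennreal (b * \<epsilon> / (R * a\<^sup>2) * geom_factor b \<rho> j)"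
  shows "ERR \<tau> \<rho> \<rho>' lam kk n a b j f \<le> ennreal \<epsilon>"
proof -
  let ?\<sigma> = "sigma \<rho> lam kk n j f" and ?G = "geom_factor b \<rho> j"
  let ?S = "lp_norm \<tau> {1..} (\<lambda>r. b ^ r * Lam \<rho>' lam kk n (j + r))"
  have G: "1 \<le> ?G"
    using exps ab j by (intro geom_factor_ge_1)
  have "?S = ennreal (1 / b ^ j) * (ennreal (b ^ j) * ?S)"
    using ab by (simp add: mult.assoc[symmetric] ennreal_mult[symmetric])
  also have "\<dots> \<le> ennreal (1 / b ^ j) * ennreal (b * \<epsilon> / (R * a\<^sup>2) * ?G)"
    using level unfolding lp_norm_shifted_geometric_weight[OF exps(1) ab(2)]
    by (rule mult_left_mono) simp
  finally have S: "?S \<le> ennreal (1 / b ^ j) * ennreal (b * \<epsilon> / (R * a\<^sup>2) * ?G)" .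
  have "ERR \<tau> \<rho> \<rho>' lam kk n a b j f
      \<le> ennreal (a * ?\<sigma>) * (ennreal (1 / b ^ j) * ennreal (b * \<epsilon> / (R * a\<^sup>2) * ?G))"
    unfolding ERR_def using S by (rule mult_left_mono) simp
  also have "\<dots> = ennreal (a * ?\<sigma> * (1 / b ^ j * (b * \<epsilon> / (R * a\<^sup>2) * ?G)))"
  proof -
    have "ennreal x * (ennreal y * ennreal z) = ennreal (x * (y * z))" if "0 \<le> x" "0 \<le> y" "0 \<le> z" for x y z
      using that by (simp add: ennreal_mult)
    then show ?thesis
      using ab R eps G by (simp add: sigma_nonneg)
  qed
  also have "\<dots> \<le> ennreal \<epsilon>"
  proof (rule ennreal_leI)
    have "a * ?\<sigma> * (1 / b ^ j * (b * \<epsilon> / (R * a\<^sup>2) * ?G)) = b * \<epsilon> / (R * a * b ^ j) * (?\<sigma> * ?G)"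
      using ab R by (simp add: power2_eq_square field_simps)
    also have "\<dots> \<le> b * \<epsilon> / (R * a * b ^ j) * (a * R * b ^ (j - 1))"
      using exps kk n f j ab R eps by (intro mult_left_mono sigma_le_of_ball) auto
    also have "\<dots> = \<epsilon> * (b * b ^ (j - 1) / b ^ j)"
      using ab R by simp
    also have "b * b ^ (j - 1) = b ^ j"
      using j by (simp add: power_eq_if)
    finally show "a * ?\<sigma> * (1 / b ^ j * (b * \<epsilon> / (R * a\<^sup>2) * ?G)) \<le> \<epsilon>"
      using ab by simp
  qed
  finally show ?thesis .
qed

theorem theorem6:
  fixes \<tau> \<rho> \<rho>' :: ennreal
    and lam :: "'k \<Rightarrow> real"
    and kk :: "nat \<Rightarrow> 'k"
    and n :: "nat \<Rightarrow> nat"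
    and a b :: real
    and C :: "('k \<Rightarrow> 'a::{real_normed_field, banach}) set"
    and ALG :: "('k, 'a) algorithm"
  assumes "1 \<le> \<tau>" and "\<tau> \<le> \<rho>"
    and "\<tau> \<le> \<rho>'" and "inverse \<rho> + inverse \<rho>' = inverse \<tau>"
    and "bij_betw kk {1..} UNIV"
    and "\<And>k. 0 < lam k"
    and "\<And>i. 1 \<le> i \<Longrightarrow> lam (kk (Suc i)) \<le> lam (kk i)"
    and "lp_norm \<rho>' UNIV lam < \<infinity>"
    and "strict_mono n"
    and "0 < b" and "b < 1" and "1 < a"
    and "C = decay_cone \<rho> lam kk n a b"
    and "ALG = cone_ALG \<tau> \<rho> \<rho>' lam kk n a b"
  shows "ALG \<in> algorithms \<tau> C
    \<and> (\<forall>f\<in>C. \<forall>\<epsilon>>0.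
         (\<exists>j\<ge>1. ERR \<tau> \<rho> \<rho>' lam kk n a b j f \<le> ennreal \<epsilon>)
       \<and> (let jstar = (LEAST j. 1 \<le> j \<and> ERR \<tau> \<rho> \<rho>' lam kk n a b j f \<le> ennreal \<epsilon>)
          in result ALG f \<epsilon> = APP kk f (n jstar) \<and> COST ALG f \<epsilon> = enat (n jstar)))
    \<and> (\<forall>R>0. \<forall>\<epsilon>>0.
         (\<exists>j\<ge>1. lp_norm \<tau> {1..} (\<lambda>r. b ^ (j + r) * Lam \<rho>' lam kk n (j + r))
                 \<le> ennreal (b * \<epsilon> / (R * a\<^sup>2) * geom_factor b \<rho> j))
       \<and> (let jdag = (LEAST j. 1 \<le> j \<and>
                        lp_norm \<tau> {1..} (\<lambda>r. b ^ (j + r) * Lam \<rho>' lam kk n (j + r))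
                        \<le> ennreal (b * \<epsilon> / (R * a\<^sup>2) * geom_factor b \<rho> j))
          in COST_max \<rho> lam ALG C \<epsilon> R \<le> enat (n jdag)))"
proof -
  note C = \<open>C = decay_cone \<rho> lam kk n a b\<close> and ALG = \<open>ALG = cone_ALG \<tau> \<rho> \<rho>' lam kk n a b\<close>
  note kk = \<open>bij_betw kk {1..} UNIV\<close> and n = \<open>strict_mono n\<close>
  have exps: "1 \<le> \<rho>" "1 \<le> \<rho>'"
    using assms(1-3) order.trans by blast+
  define jstar where
    "jstar f \<epsilon> = (LEAST j. 1 \<le> j \<and> ERR \<tau> \<rho> \<rho>' lam kk n a b j f \<le> ennreal \<epsilon>)" for f :: "'k \<Rightarrow> 'a" and \<epsilon>
  have ex: "\<exists>j\<ge>1. ERR \<tau> \<rho> \<rho>' lam kk n a b j f \<le> ennreal \<epsilon>" if "f \<in> C" "0 < \<epsilon>" for f \<epsilon>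
    using that assms(12) C by (intro exists_ERR_le[OF assms(1) exps(2) assms(8) _ assms(10,11)]) auto
  have run: "halts ALG f \<epsilon>" "result ALG f \<epsilon> = APP kk f (n (jstar f \<epsilon>))"
    "COST ALG f \<epsilon> = enat (n (jstar f \<epsilon>))" if "f \<in> C" "0 < \<epsilon>" for f \<epsilon>
    using cone_ALG_run[OF bij_betw_imp_inj_on[OF kk] n ex[OF that]]
    unfolding ALG jstar_def by blast+
  have valid: "ALG \<in> algorithms \<tau> C"
    unfolding algorithms_def
  proof (intro CollectI allI impI ballI conjI)
    fix \<epsilon> :: real and f assume eps: "0 < \<epsilon>" and f: "f \<in> C"
    show "halts ALG f \<epsilon>" "result ALG f \<epsilon> \<in> space_G \<tau>"
      using run[OF f eps] APP_in_space_G assms(1) by auto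
    have jstar: "1 \<le> jstar f \<epsilon>" "ERR \<tau> \<rho> \<rho>' lam kk n a b (jstar f \<epsilon>) f \<le> ennreal \<epsilon>"
      unfolding jstar_def using LeastI_ex[OF ex[OF f eps]] by auto
    have "norm_G \<tau> (\<lambda>k. SOL f k - result ALG f \<epsilon> k) = norm_G \<tau> (\<lambda>k. f k - APP kk f (n (jstar f \<epsilon>)) k)"
      by (simp add: SOL_def run[OF f eps])
    also have "\<dots> \<le> ERR \<tau> \<rho> \<rho>' lam kk n a b (jstar f \<epsilon>) f"
      using assms f jstar(1) by (intro norm_G_tail_le_ERR) auto
    also note jstar(2)
    finally show "norm_G \<tau> (\<lambda>k. SOL f k - result ALG f \<epsilon> k) \<le> ennreal \<epsilon>" .
  qed
  have cost: "COST_max \<rho> lam ALG C \<epsilon> R \<le> enat (n j)"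
    if j: "1 \<le> j" and R: "0 < R" and eps: "0 < \<epsilon>"
      and level: "lp_norm \<tau> {1..} (\<lambda>r. b ^ (j + r) * Lam \<rho>' lam kk n (j + r))
        \<le> ennreal (b * \<epsilon> / (R * a\<^sup>2) * geom_factor b \<rho> j)" for j R \<epsilon>
    unfolding COST_max_def
  proof (rule SUP_least)
    fix f assume f: "f \<in> C \<inter> ball_F \<rho> lam R"
    then have "ERR \<tau> \<rho> \<rho>' lam kk n a b j f \<le> ennreal \<epsilon>"
      using C by (intro ERR_le_of_ball[OF assms(1) exps(1) kk n _ _ j assms(12,10,11) R eps level]) auto
    then have "jstar f \<epsilon> \<le> j"
      unfolding jstar_def using j by (intro Least_le) simp
    then show "COST ALG f \<epsilon> \<le> enat (n j)"
      using run(3)[of f \<epsilon>] f eps n by (simp add: strict_mono_less_eq)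
  qed
  have level: "\<exists>j\<ge>1. lp_norm \<tau> {1..} (\<lambda>r. b ^ (j + r) * Lam \<rho>' lam kk n (j + r))
      \<le> ennreal (b * \<epsilon> / (R * a\<^sup>2) * geom_factor b \<rho> j)" if "0 < R" "0 < \<epsilon>" for R \<epsilon>
    using that assms exps by (intro exists_a_priori_level) auto
  show ?thesis
    unfolding Let_def
  proof (intro conjI ballI allI impI)
    show "ALG \<in> algorithms \<tau> C" by (fact valid)
  next
    fix f and \<epsilon> :: real assume "f \<in> C" "0 < \<epsilon>"
    then show "\<exists>j\<ge>1. ERR \<tau> \<rho> \<rho>' lam kk n a b j f \<le> ennreal \<epsilon>"
      "result ALG f \<epsilon> = APP kk f (n (LEAST j. 1 \<le> j \<and> ERR \<tau> \<rho> \<rho>' lam kk n a b j f \<le> ennreal \<epsilon>))"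
      "COST ALG f \<epsilon> = enat (n (LEAST j. 1 \<le> j \<and> ERR \<tau> \<rho> \<rho>' lam kk n a b j f \<le> ennreal \<epsilon>))"
      using ex run unfolding jstar_def by blast+
  next
    fix R \<epsilon> :: real assume pos: "0 < R" "0 < \<epsilon>"
    show "\<exists>j\<ge>1. lp_norm \<tau> {1..} (\<lambda>r. b ^ (j + r) * Lam \<rho>' lam kk n (j + r))
        \<le> ennreal (b * \<epsilon> / (R * a\<^sup>2) * geom_factor b \<rho> j)"
      using pos by (rule level)
    from LeastI_ex[OF this]
    show "COST_max \<rho> lam ALG C \<epsilon> R \<le> enat (n (LEAST j. 1 \<le> j \<and>
        lp_norm \<tau> {1..} (\<lambda>r. b ^ (j + r) * Lam \<rho>' lam kk n (j + r))
        \<le> ennreal (b * \<epsilon> / (R * a\<^sup>2) * geom_factor b \<rho> j)))"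
      using cost pos by blast
  qed
qed

end
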